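(* Fix $M>1$. There exists $c_1=c_1(M)>0$ such that for all $n\in\mathbb N$ and $\kappa_0\ge1$ with $n/\kappa_0\ge c_1$, $$\inf_{\widetilde G}\ \sup_{(G_0,\Sigma_0)\in\mathscr F_M(\kappa_0)}\mathbb P_{G_0,\Sigma_0}\Big(\mathfrak d_{H;\sigma_{0,[n]}}(\widetilde G,G_0)>(n/\kappa_0)^{-1/2}/c_1\Big)\ge\frac14,$$ where the infimum is over all estimators $\widetilde G$ (measurable functions of the observation $U\in\mathbb R^n$ with values in $\mathscr G$), and $$\mathscr F_M(\kappa_0)=\{(G_0,\Sigma_0):G_0\in\mathscr G(M,\infty),\ \|\mathrm{Cor}_{\Sigma_0}\|_{\mathrm{op}}\le\kappa_0\}.$$
   Context: $\mathscr G$ is the set of all probability distributions on $\mathbb R$ and $\mathscr G(M,\infty)=\{G\in\mathscr G:\mathrm{supp}(G)\subset[-M,M]\}$. $\varphi_\sigma$ is the density of $\mathcal N(0,\sigma^2)$ and $\varphi_{G;\sigma}(x)=\int\varphi_\sigma(x-u)\,G(\mathrm du)$. $\mathbb P_{G_0,\Sigma_0}$ is the law under which $U=\beta_0+\Sigma_0^{1/2}\mathsf Z_n\in\mathbb R^n$, with $\beta_0$ having i.i.d. entries distributed as $G_0$ and $\mathsf Z_n\sim\mathcal N(0,I_n)$ independent of $\beta_0$; $\Sigma_0\in\mathbb R^{n\times n}$ is a covariance matrix with positive diagonal. $\sigma_{0,j}^2=(\Sigma_0)_{jj}$ and $\mathrm{Cor}_{\Sigma_0}=\mathfrak D^{-1/2}\Sigma_0\mathfrak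 D^{-1/2}$, where $\mathfrak D$ is the diagonal part of $\Sigma_0$. $d_H^2(f,g)=\frac12\int(f^{1/2}-g^{1/2})^2$ for densities, and $\mathfrak d_{H;\sigma_{[n]}}^2(G_1,G_2)=\frac1n\sum_{j\in[n]}d_H^2(\varphi_{G_1;\sigma_j},\varphi_{G_2;\sigma_j})$. *)

theory Defs
  imports "HOL-Probability.Probability" "Jordan_Normal_Form.Matrix"
begin

definition euclid_norm :: "real Matrix.vec \<Rightarrow> real" where
  "euclid_norm v = L2_set (vec_index v) {..<dim_vec v}"

definition op_norm :: "real mat \<Rightarrow> real" where
  "op_norm A = (SUP v \<in> {v \<in> carrier_vec (dim_col A). euclid_norm v \<le> 1}. euclid_norm (A *\<^sub>v v))"

text \<open>Covariance matrices of random vectors in \<open>\<real>\<^sup>n\<close> are exactly the symmetric positive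
  semidefinite matrices; singular ones are allowed.\<close>

definition psd_mat :: "nat \<Rightarrow> real mat \<Rightarrow> bool" where
  "psd_mat n A \<longleftrightarrow> A \<in> carrier_mat n n \<and> transpose_mat A = A \<and>
     (\<forall>v \<in> carrier_vec n. 0 \<le> scalar_prod v (A *\<^sub>v v))"

text \<open>The symmetric positive semidefinite square root. It exists and is unique when
  \<open>psd_mat n S\<close> holds, and is only used in that case.\<close>

definition psd_sqrt :: "nat \<Rightarrow> real mat \<Rightarrow> real mat" where
  "psd_sqrt n S = (THE A. psd_mat n A \<and> A * A = S)"

definition std_dev :: "real mat \<Rightarrow> nat \<Rightarrow> real" where
  "std_dev S j = sqrt (S $$ (j, j))"

text \<open>The factor \<open>mat_diag n (\<lambda>j. 1 / std_dev S j)\<close> is the power \<open>-1/2\<close> of the diagonal part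
  of \<open>S\<close>, whose diagonal is positive wherever this is used.\<close>

definition correlation_mat :: "nat \<Rightarrow> real mat \<Rightarrow> real mat" where
  "correlation_mat n S =
     mat_diag n (\<lambda>j. 1 / std_dev S j) * S * mat_diag n (\<lambda>j. 1 / std_dev S j)"

text \<open>The set of all Borel probability measures on \<open>\<real>\<close> is \<open>space (prob_algebra borel)\<close>. Its
  sigma-algebra is generated by the evaluations \<open>G \<mapsto> G A\<close>, i.e. it is the Borel sigma-algebra
  of the topology of weak convergence.\<close>

definition topological_support :: "real measure \<Rightarrow> real set" where
  "topological_support G = {x. \<forall>V. open V \<and> x \<in> V \<longrightarrow> 0 < measure G V}"

definition compact_priors :: "real \<Rightarrow> real measure set" where
  "compact_priors M = {G \<in> space (prob_algebra borel). topological_support G \<subseteq> {-M..M}}"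

text \<open>Here \<open>\<sigma>\<close> is a standard deviation.\<close>

definition normal_mixture :: "real measure \<Rightarrow> real \<Rightarrow> real \<Rightarrow> real" where
  "normal_mixture G \<sigma> x = (LINT u|G. normal_density 0 \<sigma> (x - u))"

definition hellinger_sq :: "(real \<Rightarrow> real) \<Rightarrow> (real \<Rightarrow> real) \<Rightarrow> real" where
  "hellinger_sq f g = 1 / 2 * (LINT x|lborel. (sqrt (f x) - sqrt (g x))\<^sup>2)"

definition avg_hellinger :: "nat \<Rightarrow> (nat \<Rightarrow> real) \<Rightarrow> real measure \<Rightarrow> real measure \<Rightarrow> real" where
  "avg_hellinger n \<sigma> G H =
     sqrt (1 / real n * (\<Sum>j<n. hellinger_sq (normal_mixture G (\<sigma> j)) (normal_mixture H (\<sigma> j))))"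

text \<open>\<open>\<real>\<^sup>n\<close> as a measurable space: extensional functions on the index set \<open>{..<n}\<close>.\<close>

abbreviation obs_space :: "nat \<Rightarrow> (nat \<Rightarrow> real) measure" where
  "obs_space n \<equiv> PiM {..<n} (\<lambda>_. borel)"

definition obs_law :: "nat \<Rightarrow> real measure \<Rightarrow> real mat \<Rightarrow> (nat \<Rightarrow> real) measure" where
  "obs_law n G S =
     distr (PiM {..<n} (\<lambda>_. G) \<Otimes>\<^sub>M PiM {..<n} (\<lambda>_. density lborel std_normal_density)) (obs_space n)
       (\<lambda>(\<beta>, z). \<lambda>i\<in>{..<n}. \<beta> i + vec_index (psd_sqrt n S *\<^sub>v Matrix.vec n z) i)"

definition param_class :: "nat \<Rightarrow> real \<Rightarrow> real \<Rightarrow> (real measure \<times> real mat) set" where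
  "param_class n M \<kappa> =
     {(G, S). G \<in> compact_priors M \<and> psd_mat n S \<and> (\<forall>j<n. 0 < S $$ (j, j)) \<and>
        op_norm (correlation_mat n S) \<le> \<kappa>}"

end

theory Submission
  imports Defs
begin

text \<open>Two-point argument. Take the equicorrelation matrix \<open>S = (1 - r) I + r J\<close> with operator norm
  \<open>k\<close> and compare the point masses at \<open>a\<close> and \<open>- a\<close>. Since \<open>S\<^sup>1\<^sup>/\<^sup>2\<close> maps the all-ones vector to \<open>sqrt k\<close>
  times itself, the observation is the image under \<open>S\<^sup>1\<^sup>/\<^sup>2\<close> of a standard Gaussian vector whose
  coordinates are all shifted by \<open>b = a / sqrt k\<close> or \<open>- b\<close>. If \<open>a\<close> is a small multiple of
  \<open>sqrt (k / n)\<close>, then \<open>n b\<^sup>2\<close> is small and the two laws cannot be told apart, while the Hellinger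
  distance of the corresponding mixtures is of order \<open>a\<close>.\<close>

section \<open>Likelihood ratios of shifted Gaussian vectors\<close>

text \<open>Product measures are determined by their values on boxes. The indicator of a box
  factorises over the coordinates, so its integral against the product density splits into
  one-dimensional integrals.\<close>

lemma PiM_density:
  fixes f :: "'i \<Rightarrow> 'a \<Rightarrow> ennreal"
  assumes "finite I" "\<And>i. sigma_finite_measure (M i)" "\<And>i. sigma_finite_measure (density (M i) (f i))"
    and [measurable]: "\<And>i. f i \<in> borel_measurable (M i)"
  shows "PiM I (\<lambda>i. density (M i) (f i)) = density (PiM I M) (\<lambda>x. \<Prod>i\<in>I. f i (x i))"
proof -
  interpret M: product_sigma_finite M
    using assms by (simp add: product_sigma_finite_def)
  interpret D: product_sigma_finite "\<lambda>i. density (M i) (f i)"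
    using assms by (simp add: product_sigma_finite_def)
  have "density (PiM I M) (\<lambda>x. \<Prod>i\<in>I. f i (x i)) = PiM I (\<lambda>i. density (M i) (f i))"
  proof (rule D.PiM_eqI)
    show "sets (density (PiM I M) (\<lambda>x. \<Prod>i\<in>I. f i (x i))) = sets (PiM I (\<lambda>i. density (M i) (f i)))"
      by (simp cong: sets_PiM_cong)
    fix A assume "\<And>i. i \<in> I \<Longrightarrow> A i \<in> sets (density (M i) (f i))"
    then have A[measurable]: "\<And>i. i \<in> I \<Longrightarrow> A i \<in> sets (M i)" by simp
    have ind: "indicator (Pi\<^sub>E I A) x = (\<Prod>i\<in>I. indicator (A i) (x i) :: ennreal)"
      if "x \<in> space (PiM I M)" for x
      using that \<open>finite I\<close>
      by (auto simp: indicator_def space_PiM PiE_iff prod_zero_iff)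
    have "emeasure (density (PiM I M) (\<lambda>x. \<Prod>i\<in>I. f i (x i))) (Pi\<^sub>E I A)
        = (\<integral>\<^sup>+x. (\<Prod>i\<in>I. f i (x i)) * indicator (Pi\<^sub>E I A) x \<partial>PiM I M)"
      by (rule emeasure_density) (use \<open>finite I\<close> in \<open>auto intro!: sets_PiM_I_finite borel_measurable_prod_ennreal A\<close>)
    also have "\<dots> = (\<integral>\<^sup>+x. (\<Prod>i\<in>I. f i (x i) * indicator (A i) (x i)) \<partial>PiM I M)"
      by (intro nn_integral_cong) (simp add: ind prod.distrib)
    also have "\<dots> = (\<Prod>i\<in>I. \<integral>\<^sup>+x. f i x * indicator (A i) x \<partial>M i)"
      by (rule M.product_nn_integral_prod) (use \<open>finite I\<close> in auto)
    also have "\<dots> = (\<Prod>i\<in>I. emeasure (density (M i) (f i)) (A i))"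
      by (intro prod.cong refl) (simp add: emeasure_density)
    finally show "emeasure (density (PiM I M) (\<lambda>x. \<Prod>i\<in>I. f i (x i))) (Pi\<^sub>E I A)
        = (\<Prod>i\<in>I. emeasure (density (M i) (f i)) (A i))" .
  qed fact
  then show ?thesis by simp
qed

definition std_gauss :: "real measure" where
  "std_gauss = density lborel std_normal_density"

lemma std_gauss_borel [simp, measurable_cong]: "sets std_gauss = sets borel"
  by (simp add: std_gauss_def)

lemma space_std_gauss [simp]: "space std_gauss = UNIV"
  by (simp add: std_gauss_def)

lemma prob_space_std_gauss: "prob_space std_gauss"
  unfolding std_gauss_def by (rule prob_space_normal_density) simp

lemma shifted_normal_eq:
  "normal_density 0 1 (x - b) = std_normal_density x * exp (b * x - b\<^sup>2 / 2)"
  by (simp add: normal_density_def exp_add[symmetric] power2_eq_square algebra_simps diff_divide_distrib add_divide_distrib)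

text \<open>The one-dimensional Cameron-Martin formula: Lebesgue measure is translation invariant,
  so only the normal density moves, and the exponential is its ratio to the unshifted
  density.\<close>

lemma distr_std_gauss_shift:
  "distr std_gauss std_gauss (\<lambda>x. x + b) = density std_gauss (\<lambda>x. ennreal (exp (b * x - b\<^sup>2 / 2)))"
proof -
  have "distr std_gauss std_gauss (\<lambda>x. x + b) = distr (density lborel (\<lambda>x. ennreal (std_normal_density ((x + b) - b)))) lborel (\<lambda>x. x + b)"
    unfolding std_gauss_def by (intro distr_cong) auto
  also have "\<dots> = density (distr lborel lborel (\<lambda>x. x + b)) (\<lambda>x. ennreal (std_normal_density (x - b)))"
    by (rule density_distr[symmetric]) auto
  also have "distr lborel lborel (\<lambda>x. x + b) = lborel"
    using lborel_distr_plus[of b] by (simp add: add.commute cong: distr_cong)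
  also have "density lborel (\<lambda>x. ennreal (std_normal_density (x - b)))
     = density lborel (\<lambda>x. ennreal (std_normal_density x) * ennreal (exp (b * x - b\<^sup>2 / 2)))"
    by (simp add: shifted_normal_eq ennreal_mult')
  also have "\<dots> = density std_gauss (\<lambda>x. ennreal (exp (b * x - b\<^sup>2 / 2)))"
    unfolding std_gauss_def by (subst density_density_eq) auto
  finally show ?thesis .
qed

lemma integral_std_gauss_exp:
  "integrable std_gauss (\<lambda>x. exp (b * x))" "(LINT x|std_gauss. exp (b * x)) = exp (b\<^sup>2 / 2)"
proof -
  \<comment> \<open>Completing the square: exponential tilting moves the mean of the standard normal
    density to \<open>b\<close>.\<close>
  have *: "std_normal_density x *\<^sub>R exp (b * x) = exp (b\<^sup>2 / 2) * normal_density b 1 x" for x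
    by (simp add: normal_density_def exp_add[symmetric] power2_eq_square algebra_simps diff_divide_distrib add_divide_distrib)
  show "integrable std_gauss (\<lambda>x. exp (b * x))"
    unfolding std_gauss_def by (subst integrable_density) (auto simp only: * intro!: integrable_mult_right, auto)
  show "(LINT x|std_gauss. exp (b * x)) = exp (b\<^sup>2 / 2)"
    unfolding std_gauss_def by (subst integral_density) (auto simp only: *, auto)
qed

definition gauss_vec :: "nat \<Rightarrow> (nat \<Rightarrow> real) measure" where
  "gauss_vec n = PiM {..<n} (\<lambda>_. std_gauss)"

lemma sets_gauss_vec [simp, measurable_cong]: "sets (gauss_vec n) = sets (obs_space n)"
  unfolding gauss_vec_def by (rule sets_PiM_cong) auto

lemma space_gauss_vec [simp]: "space (gauss_vec n) = space (obs_space n)"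
  by (rule sets_eq_imp_space_eq) simp

lemma prob_space_gauss_vec: "prob_space (gauss_vec n)"
  unfolding gauss_vec_def by (intro prob_space_PiM prob_space_std_gauss)

text \<open>Likelihood ratio of the Gaussian vector shifted by \<open>b\<close> in every coordinate
  against the unshifted one; \<open>distr_gauss_vec_shift\<close> confirms this.\<close>

definition shift_lr :: "nat \<Rightarrow> real \<Rightarrow> (nat \<Rightarrow> real) \<Rightarrow> real" where
  "shift_lr n b z = (\<Prod>i<n. exp (b * z i - b\<^sup>2 / 2))"

lemma shift_lr_measurable [measurable]: "shift_lr n b \<in> borel_measurable (obs_space n)"
  unfolding shift_lr_def by measurable

lemma shift_lr_nonneg [simp]: "0 \<le> shift_lr n b z"
  by (simp add: shift_lr_def prod_nonneg)

text \<open>Supplies the second and mixed moments of the likelihood ratios. The integrand is again a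
  product over coordinates, and each factor is a moment generating function at \<open>b + c\<close>,
  where the squares cancel and leave \<open>b * c\<close>. The case \<open>c = 0\<close> covers a
  single ratio.\<close>

lemma shift_lr_mult_integral:
  "integrable (gauss_vec n) (\<lambda>z. shift_lr n b z * shift_lr n c z)"
  "(LINT z|gauss_vec n. shift_lr n b z * shift_lr n c z) = exp (real n * (b * c))"
proof -
  interpret product_sigma_finite "\<lambda>_::nat. std_gauss"
    by (simp add: product_sigma_finite_def prob_space_imp_sigma_finite prob_space_std_gauss)
  have eq: "shift_lr n b z * shift_lr n c z
      = (\<Prod>i<n. exp (- (b\<^sup>2 + c\<^sup>2) / 2) * exp ((b + c) * z i))" for z
    unfolding shift_lr_def prod.distrib[symmetric]
    by (intro prod.cong refl) (simp add: exp_add[symmetric] algebra_simps diff_divide_distrib add_divide_distrib)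
  have i: "integrable std_gauss (\<lambda>x. exp (- (b\<^sup>2 + c\<^sup>2) / 2) * exp ((b + c) * x))"
    by (intro integrable_mult_right integral_std_gauss_exp)
  have "(LINT x|std_gauss. exp (- (b\<^sup>2 + c\<^sup>2) / 2) * exp ((b + c) * x))
      = exp (- (b\<^sup>2 + c\<^sup>2) / 2 + (b + c)\<^sup>2 / 2)"
    by (simp only: integral_mult_right_zero integral_std_gauss_exp exp_add)
  also have "- (b\<^sup>2 + c\<^sup>2) / 2 + (b + c)\<^sup>2 / 2 = b * c"
    by (simp add: power2_eq_square algebra_simps add_divide_distrib diff_divide_distrib)
  finally have I: "(LINT x|std_gauss. exp (- (b\<^sup>2 + c\<^sup>2) / 2) * exp ((b + c) * x)) = exp (b * c)" .
  show "integrable (gauss_vec n) (\<lambda>z. shift_lr n b z * shift_lr n c z)"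
    unfolding eq gauss_vec_def by (rule product_integrable_prod) (use i in auto)
  have "(LINT z|gauss_vec n. shift_lr n b z * shift_lr n c z) = (\<Prod>i<n. exp (b * c))"
    unfolding eq gauss_vec_def by (subst product_integral_prod) (use i I in auto)
  then show "(LINT z|gauss_vec n. shift_lr n b z * shift_lr n c z) = exp (real n * (b * c))"
    by (simp add: exp_of_nat_mult)
qed

lemma shift_lr_0 [simp]: "shift_lr n 0 z = 1"
  by (simp add: shift_lr_def)

lemma shift_lr_integrable: "integrable (gauss_vec n) (\<lambda>z. shift_lr n b z)"
  using shift_lr_mult_integral(1)[of n b 0] by simp

definition shift_vec :: "nat \<Rightarrow> real \<Rightarrow> (nat \<Rightarrow> real) \<Rightarrow> nat \<Rightarrow> real" where
  "shift_vec n b z = (\<lambda>i\<in>{..<n}. z i + b)"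

lemma shift_vec_measurable [measurable]: "shift_vec n b \<in> measurable (obs_space n) (obs_space n)"
  unfolding shift_vec_def by measurable

lemma distr_gauss_vec_shift:
  "distr (gauss_vec n) (gauss_vec n) (shift_vec n b) = density (gauss_vec n) (\<lambda>z. ennreal (shift_lr n b z))"
proof -
  \<comment> \<open>\<open>PiM_density\<close> asks for sigma-finite factors; the tilted factor is
    even a probability measure, being an image of one.\<close>
  have p: "prob_space (distr std_gauss std_gauss (\<lambda>x. x + b))"
    by (rule prob_space.prob_space_distr[OF prob_space_std_gauss]) simp
  have "distr (gauss_vec n) (gauss_vec n) (shift_vec n b)
      = distr (gauss_vec n) (gauss_vec n) (compose {..<n} (\<lambda>x. x + b))"
    by (simp add: shift_vec_def compose_def cong: distr_cong)
  also have "\<dots> = PiM {..<n} (\<lambda>_. distr std_gauss std_gauss (\<lambda>x. x + b))"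
    unfolding gauss_vec_def by (rule distr_PiM_finite_prob_space') (auto intro: prob_space_std_gauss)
  also have "\<dots> = PiM {..<n} (\<lambda>_. density std_gauss (\<lambda>x. ennreal (exp (b * x - b\<^sup>2 / 2))))"
    by (simp only: distr_std_gauss_shift)
  also have "\<dots> = density (gauss_vec n) (\<lambda>z. \<Prod>i<n. ennreal (exp (b * z i - b\<^sup>2 / 2)))"
    unfolding gauss_vec_def
    by (rule PiM_density)
      (use p in \<open>auto intro: prob_space_imp_sigma_finite prob_space_std_gauss simp: distr_std_gauss_shift\<close>)
  also have "\<dots> = density (gauss_vec n) (\<lambda>z. ennreal (shift_lr n b z))"
    by (simp add: shift_lr_def prod_ennreal)
  finally show ?thesis .
qed

text \<open>Expresses probabilities under different shifts as integrals against one common measure,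
  so that they can be subtracted under the integral sign.\<close>

lemma measure_gauss_vec_shift:
  assumes [measurable]: "X \<in> sets (obs_space n)"
  shows "measure (gauss_vec n) (shift_vec n b -` X \<inter> space (obs_space n))
    = (LINT z|gauss_vec n. shift_lr n b z * indicator X z)"
proof -
  have "emeasure (gauss_vec n) (shift_vec n b -` X \<inter> space (obs_space n))
      = emeasure (distr (gauss_vec n) (gauss_vec n) (shift_vec n b)) X"
    by (subst emeasure_distr) auto
  also have "\<dots> = (\<integral>\<^sup>+z. ennreal (shift_lr n b z * indicator X z) \<partial>gauss_vec n)"
    unfolding distr_gauss_vec_shift
    by (subst emeasure_density) (auto intro!: nn_integral_cong simp: indicator_def)
  also have "\<dots> = ennreal (LINT z|gauss_vec n. shift_lr n b z * indicator X z)"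
    by (intro nn_integral_eq_integral integrable_real_mult_indicator)
      (auto intro: shift_lr_integrable)
  finally show ?thesis
    by (simp add: measure_def integral_nonneg_AE)
qed

text \<open>The pointwise bound \<open>x \<le> 1/4 + x\<^sup>2\<close> takes the place of the Cauchy-Schwarz inequality: it
  reduces the \<open>L\<^sup>1\<close> distance of the likelihood ratios to their second moments.\<close>

lemma gauss_vec_shift_indistinguishable:
  assumes X: "X \<in> sets (obs_space n)" and b: "real n * b\<^sup>2 \<le> 1/64"
  shows "measure (gauss_vec n) (shift_vec n b -` X \<inter> space (obs_space n))
    \<le> measure (gauss_vec n) (shift_vec n (- b) -` X \<inter> space (obs_space n)) + 1/2"
proof -
  note X[measurable]
  interpret prob_space "gauss_vec n" by (rule prob_space_gauss_vec)
  let ?L = "shift_lr n b" and ?K = "shift_lr n (- b)"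
  \<comment> \<open>This is \<open>1/4 + (?L z - ?K z)\<^sup>2\<close> multiplied out, so that every
    term has a known integral. Being nonnegative, it also covers the points off \<open>X\<close>,
    where the difference to be bounded is 0.\<close>
  let ?q = "\<lambda>z. 1/4 + (?L z * ?L z - 2 * (?L z * ?K z) + ?K z * ?K z)"
  have i: "integrable (gauss_vec n) (\<lambda>z. shift_lr n c z * indicator X z)" for c
    by (rule integrable_real_mult_indicator) (auto intro: shift_lr_integrable)
  have q: "integrable (gauss_vec n) ?q"
    by (intro Bochner_Integration.integrable_add Bochner_Integration.integrable_diff integrable_mult_right
        shift_lr_mult_integral(1) integrable_const)
  have pw: "?L z * indicator X z - ?K z * indicator X z \<le> ?q z" for z
  proof -
    have "?q z = 1/4 + (?L z - ?K z)\<^sup>2" by (simp add: power2_eq_square algebra_simps)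
    moreover have "?L z - ?K z \<le> 1/4 + (?L z - ?K z)\<^sup>2"
      using zero_le_power2[of "?L z - ?K z - 1/2"] by (simp add: power2_eq_square algebra_simps)
    ultimately show ?thesis
      using zero_le_power2[of "?L z - ?K z"] by (auto simp: indicator_def)
  qed
  have "(LINT z|gauss_vec n. ?L z * indicator X z) - (LINT z|gauss_vec n. ?K z * indicator X z)
     = (LINT z|gauss_vec n. ?L z * indicator X z - ?K z * indicator X z)"
    by (simp add: i)
  also have "\<dots> \<le> (LINT z|gauss_vec n. ?q z)"
    by (intro integral_mono q Bochner_Integration.integrable_diff i pw)
  also have "\<dots> = 1/4 + (2 * exp (real n * b\<^sup>2) - 2 * exp (- (real n * b\<^sup>2)))"
    by (simp add: shift_lr_mult_integral prob_space[unfolded space_gauss_vec] power2_eq_square)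
  \<comment> \<open>For \<open>y = real n * b\<^sup>2\<close> the bracket is at most
    \<open>2 * (1 + 2 * y) - 2 * (1 - y) = 6 * y\<close>, and \<open>6/64 < 1/4\<close>.\<close>
  also have "\<dots> \<le> 1/2"
  proof -
    let ?y = "real n * b\<^sup>2"
    have "0 \<le> ?y" by simp
    have "exp ?y \<le> 1 + ?y + ?y\<^sup>2" by (rule exp_bound) (use b in auto)
    moreover have "?y\<^sup>2 \<le> ?y * 1" unfolding power2_eq_square[of ?y]
      by (rule mult_left_mono) (use b in auto)
    moreover have "1 - ?y \<le> exp (- ?y)" using exp_ge_add_one_self[of "- ?y"] by simp
    ultimately show ?thesis using b by linarith
  qed
  finally show ?thesis by (simp add: measure_gauss_vec_shift[OF X])
qed

section \<open>Equicorrelation matrices and their square roots\<close>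

lemma scalar_prod_self_eq_0:
  fixes v :: "real Matrix.vec"
  assumes "scalar_prod v v \<le> 0"
  shows "v = 0\<^sub>v (dim_vec v)"
proof -
  have "(\<Sum>i = 0..<dim_vec v. (vec_index v i)\<^sup>2) = 0"
    using assms by (intro antisym sum_nonneg) (auto simp: scalar_prod_def power2_eq_square)
  then show ?thesis
    by (auto simp: sum_nonneg_eq_0_iff)
qed

text \<open>With \<open>w = B v - l v\<close> one has \<open>B w = - l w\<close>, which positivity of \<open>B\<close> only permits for \<open>w = 0\<close>
  when \<open>l > 0\<close>.\<close>

lemma psd_mat_eigenvector_of_square:
  assumes B: "psd_mat n B" and v: "v \<in> carrier_vec n" and "0 \<le> l"
    and eq: "B *\<^sub>v (B *\<^sub>v v) = l\<^sup>2 \<cdot>\<^sub>v v"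
  shows "B *\<^sub>v v = l \<cdot>\<^sub>v v"
proof -
  have Bc: "B \<in> carrier_mat n n" and sym: "transpose_mat B = B"
    and pos: "\<And>v. v \<in> carrier_vec n \<Longrightarrow> 0 \<le> scalar_prod v (B *\<^sub>v v)"
    using B by (auto simp: psd_mat_def)
  have Bv: "B *\<^sub>v v \<in> carrier_vec n" using Bc v by simp
  define w where "w = B *\<^sub>v v - l \<cdot>\<^sub>v v"
  have w: "w \<in> carrier_vec n" using Bv v by (simp add: w_def)
  have "scalar_prod w w \<le> 0"
  proof (cases "l = 0")
    \<comment> \<open>For \<open>l = 0\<close> the sign argument gives nothing. Symmetry moves one
      factor \<open>B\<close> across instead: the squared norm of \<open>B *\<^sub>v v\<close> is
      the product of \<open>v\<close> with \<open>B *\<^sub>v (B *\<^sub>v v) = 0\<close>.\<close>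
    case True
    have "scalar_prod (B *\<^sub>v v) (B *\<^sub>v v) = scalar_prod v (transpose_mat B *\<^sub>v (B *\<^sub>v v))"
      using transpose_vec_mult_scalar[OF Bc v Bv] comm_scalar_prod[OF v mult_mat_vec_carrier[OF Bc Bv]]
      by (simp add: sym)
    also have "\<dots> = 0" using True v by (simp add: sym eq)
    also have "B *\<^sub>v v = w" using True v Bv Bc unfolding w_def by (intro eq_vecI) auto
    finally show ?thesis by simp
  next
    case False
    have "B *\<^sub>v w = l\<^sup>2 \<cdot>\<^sub>v v - l \<cdot>\<^sub>v (B *\<^sub>v v)"
      unfolding w_def using Bc v Bv by (simp add: mult_minus_distrib_mat_vec mult_mat_vec eq)
    also have "\<dots> = (- l) \<cdot>\<^sub>v w"
      unfolding w_def using v Bv Bc by (intro eq_vecI) (auto simp: algebra_simps power2_eq_square)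
    finally have "scalar_prod w (B *\<^sub>v w) = - l * scalar_prod w w" using w by simp
    with pos[OF w] have "l * scalar_prod w w \<le> 0" by simp
    then show ?thesis using False \<open>0 \<le> l\<close> by (simp add: mult_le_0_iff)
  qed
  from scalar_prod_self_eq_0[OF this] have "w = 0\<^sub>v n" using w by simp
  have "vec_index (B *\<^sub>v v) i = vec_index (l \<cdot>\<^sub>v v) i" if "i < n" for i
  proof -
    have "vec_index w i = 0" using \<open>w = 0\<^sub>v n\<close> that by simp
    then show ?thesis using that Bv v Bc by (simp add: w_def)
  qed
  then show ?thesis using v Bc by (intro eq_vecI) auto
qed

text \<open>\<open>a\<close> times the identity plus \<open>g\<close> times the all-ones matrix. The
  family is closed under products, so the square root of an equicorrelation matrix can be found
  inside it.\<close>

definition exch_mat :: "nat \<Rightarrow> real \<Rightarrow> real \<Rightarrow> real mat" where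
  "exch_mat n a g = mat n n (\<lambda>(i, j). (if i = j then a else 0) + g)"

lemma exch_mat_carrier [simp]: "exch_mat n a g \<in> carrier_mat n n"
  by (simp add: exch_mat_def)

lemma exch_mat_dim [simp]: "dim_row (exch_mat n a g) = n" "dim_col (exch_mat n a g) = n"
  by (simp_all add: exch_mat_def)

lemma exch_mat_mult_vec:
  assumes "v \<in> carrier_vec n"
  shows "exch_mat n a g *\<^sub>v v
    = Matrix.vec n (\<lambda>i. a * vec_index v i + g * (\<Sum>j<n. vec_index v j))"
proof (rule eq_vecI)
  fix i assume "i < dim_vec (Matrix.vec n (\<lambda>i. a * vec_index v i + g * (\<Sum>j<n. vec_index v j)))"
  then have i: "i < n" by simp
  then have "vec_index (exch_mat n a g *\<^sub>v v) i
      = (\<Sum>j<n. (if i = j then a * vec_index v j else 0) + g * vec_index v j)"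
    using assms
    by (auto simp: exch_mat_def scalar_prod_def lessThan_atLeast0 algebra_simps intro!: sum.cong)
  with i show "vec_index (exch_mat n a g *\<^sub>v v) i
      = vec_index (Matrix.vec n (\<lambda>i. a * vec_index v i + g * (\<Sum>j<n. vec_index v j))) i"
    by (simp add: sum.distrib sum_distrib_left)
qed simp

lemma exch_mat_mult:
  "exch_mat n a g * exch_mat n a' g' = exch_mat n (a * a') (a * g' + g * a' + real n * g * g')"
proof (rule eq_matI)
  fix i j assume "i < dim_row (exch_mat n (a * a') (a * g' + g * a' + real n * g * g'))"
    "j < dim_col (exch_mat n (a * a') (a * g' + g * a' + real n * g * g'))"
  then have ij: "i < n" "j < n" by simp_all
  have "(exch_mat n a g * exch_mat n a' g') $$ (i, j)
     = vec_index (exch_mat n a g *\<^sub>v col (exch_mat n a' g') j) i"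
    using ij by simp
  also have "\<dots> = a * ((if i = j then a' else 0) + g') + g * (\<Sum>k<n. (if k = j then a' else 0) + g')"
    using ij by (subst exch_mat_mult_vec) (auto simp: exch_mat_def simp del: index_mult_mat_vec)
  also have "\<dots> = exch_mat n (a * a') (a * g' + g * a' + real n * g * g') $$ (i, j)"
    using ij by (simp add: exch_mat_def sum.distrib algebra_simps)
  finally show "(exch_mat n a g * exch_mat n a' g') $$ (i, j)
     = exch_mat n (a * a') (a * g' + g * a' + real n * g * g') $$ (i, j)" .
qed simp_all

text \<open>The quadratic form is \<open>a\<close> times the squared norm plus \<open>g\<close>
  times the squared coordinate sum.\<close>

lemma psd_exch_mat:
  assumes "0 \<le> a" "0 \<le> g"
  shows "psd_mat n (exch_mat n a g)"
  unfolding psd_mat_def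
proof (intro conjI ballI)
  show "transpose_mat (exch_mat n a g) = exch_mat n a g"
    by (auto simp: exch_mat_def)
  fix v :: "real Matrix.vec" assume v: "v \<in> carrier_vec n"
  have "scalar_prod v (exch_mat n a g *\<^sub>v v)
      = (\<Sum>i<n. vec_index v i * (a * vec_index v i + g * (\<Sum>j<n. vec_index v j)))"
    using v by (auto simp: scalar_prod_def exch_mat_mult_vec lessThan_atLeast0 intro!: sum.cong)
  also have "\<dots> = a * (\<Sum>i<n. (vec_index v i)\<^sup>2) + g * (\<Sum>i<n. vec_index v i)\<^sup>2"
    by (simp add: algebra_simps sum.distrib sum_distrib_left sum_distrib_right power2_eq_square)
  also have "0 \<le> \<dots>" using assms by (intro add_nonneg_nonneg mult_nonneg_nonneg sum_nonneg) auto
  finally show "0 \<le> scalar_prod v (exch_mat n a g *\<^sub>v v)" .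
qed simp

text \<open>A square root has the same eigenvectors: the all-ones vector and the centred coordinate
  vectors, which together span everything.\<close>

lemma psd_sqrt_exch_mat:
  assumes n: "0 < n" and ag: "0 \<le> a" "0 \<le> g"
  shows "psd_sqrt n (exch_mat n a g * exch_mat n a g) = exch_mat n a g"
  unfolding psd_sqrt_def
proof (rule the_equality)
  let ?E = "exch_mat n a g"
  fix B assume B: "psd_mat n B \<and> B * B = ?E * ?E"
  then have Bc: "B \<in> carrier_mat n n" by (simp add: psd_mat_def)
  \<comment> \<open>Since \<open>B * B = ?E * ?E\<close>, an eigenvector of \<open>?E\<close> for
    \<open>l\<close> satisfies the squared equation for \<open>B\<close>, and \<open>l\<close> is
    the nonnegative root.\<close>
  have eig: "B *\<^sub>v v = l \<cdot>\<^sub>v v"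
    if v: "v \<in> carrier_vec n" and l: "0 \<le> l" and E: "?E *\<^sub>v v = l \<cdot>\<^sub>v v" for v l
  proof (rule psd_mat_eigenvector_of_square[OF _ v l])
    have "B *\<^sub>v (B *\<^sub>v v) = ?E *\<^sub>v (?E *\<^sub>v v)"
      using B Bc v assoc_mult_mat_vec[OF Bc Bc v] assoc_mult_mat_vec[of ?E n n ?E n v] by simp
    also have "\<dots> = l\<^sup>2 \<cdot>\<^sub>v v"
      using v by (simp add: E mult_mat_vec[OF exch_mat_carrier] smult_smult_assoc power2_eq_square)
    finally show "B *\<^sub>v (B *\<^sub>v v) = l\<^sup>2 \<cdot>\<^sub>v v" .
  qed (use B in simp)
  \<comment> \<open>Coordinate sum 1 makes \<open>?e - u\<close> sum to zero. Thus
    \<open>?e = (?e - u) + u\<close> splits a unit vector into eigenvectors for \<open>a\<close> and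
    for \<open>a + real n * g\<close>, which determines column \<open>j\<close> of
    \<open>B\<close>.\<close>
  define u where "u = Matrix.vec n (\<lambda>_. 1 / real n)"
  have u: "u \<in> carrier_vec n" by (simp add: u_def)
  have su: "(\<Sum>j<n. vec_index u j) = 1" using n by (simp add: u_def)
  have Bu: "B *\<^sub>v u = (a + real n * g) \<cdot>\<^sub>v u"
    using ag n u by (intro eig eq_vecI) (auto simp: exch_mat_mult_vec[OF u] su, auto simp: u_def algebra_simps)
  show "B = ?E"
  proof (rule eq_matI)
    fix i j assume "i < dim_row ?E" "j < dim_col ?E"
    then have ij: "i < n" "j < n" by simp_all
    let ?e = "unit_vec n j :: real Matrix.vec"
    have e: "?e \<in> carrier_vec n" by simp
    have se: "(\<Sum>k<n. vec_index ?e k) = 1" using ij by (simp add: unit_vec_def)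
    have d: "?e - u \<in> carrier_vec n" using u by simp
    have sd: "(\<Sum>k<n. vec_index (?e - u) k) = 0"
      using u se su by (simp add: sum_subtractf del: index_unit_vec)
    have Bd: "B *\<^sub>v (?e - u) = a \<cdot>\<^sub>v (?e - u)"
      using ag d u by (intro eig eq_vecI) (auto simp: exch_mat_mult_vec[OF d] sd simp del: index_minus_vec(1))
    have "B $$ (i, j) = vec_index (B *\<^sub>v ?e) i"
      using ij Bc by (simp add: scalar_prod_right_unit)
    also have "B *\<^sub>v ?e = B *\<^sub>v (?e - u) + B *\<^sub>v u"
    proof -
      have "?e = (?e - u) + u" using u by (intro eq_vecI) auto
      then have "B *\<^sub>v ?e = B *\<^sub>v ((?e - u) + u)" by simp
      also have "\<dots> = B *\<^sub>v (?e - u) + B *\<^sub>v u" by (rule mult_add_distrib_mat_vec[OF Bc d u])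
      finally show ?thesis .
    qed
    also have "vec_index \<dots> i = a * (vec_index ?e i - 1 / real n) + (a + real n * g) * (1 / real n)"
      unfolding Bd Bu using ij by (simp add: u_def)
    also have "\<dots> = ?E $$ (i, j)"
      using ij n by (simp add: exch_mat_def unit_vec_def field_simps)
    finally show "B $$ (i, j) = ?E $$ (i, j)" .
  qed (use Bc in auto)
qed (use psd_exch_mat[OF ag] in simp)

text \<open>Triangle inequality: the identity part contributes \<open>a\<close>. In the all-ones
  part, Cauchy-Schwarz bounds the coordinate sum by \<open>sqrt n\<close>, and a constant vector has
  norm \<open>sqrt n\<close> times its entry.\<close>

lemma op_norm_exch_mat_le:
  assumes ag: "0 \<le> a" "0 \<le> g"
  shows "op_norm (exch_mat n a g) \<le> a + real n * g"
  unfolding op_norm_def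
proof (rule cSUP_least)
  show "{v \<in> carrier_vec (dim_col (exch_mat n a g)). euclid_norm v \<le> 1} \<noteq> {}"
    by (auto simp: euclid_norm_def L2_set_def intro!: exI[of _ "0\<^sub>v n"])
  fix v assume "v \<in> {v \<in> carrier_vec (dim_col (exch_mat n a g)). euclid_norm v \<le> 1}"
  then have v: "v \<in> carrier_vec n" and nv: "L2_set (vec_index v) {..<n} \<le> 1"
    by (auto simp: euclid_norm_def)
  let ?s = "\<Sum>j<n. vec_index v j" and ?l = "L2_set (vec_index v) {..<n}"
  have "\<bar>?s\<bar> \<le> (\<Sum>j<n. \<bar>1\<bar> * \<bar>vec_index v j\<bar>)" by simp
  also have "\<dots> \<le> L2_set (\<lambda>_. 1) {..<n} * ?l" by (rule L2_set_mult_ineq)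
  also have "\<dots> = sqrt (real n) * ?l" by (simp add: L2_set_def)
  also have "\<dots> \<le> sqrt (real n)" using nv by (simp add: mult_left_le)
  finally have s: "\<bar>?s\<bar> \<le> sqrt (real n)" .
  have "euclid_norm (exch_mat n a g *\<^sub>v v) = L2_set (\<lambda>i. a * vec_index v i + g * ?s) {..<n}"
    unfolding euclid_norm_def using v by (auto simp: exch_mat_mult_vec intro!: L2_set_cong)
  also have "\<dots> \<le> L2_set (\<lambda>i. a * vec_index v i) {..<n} + L2_set (\<lambda>i. g * ?s) {..<n}"
    by (rule L2_set_triangle_ineq)
  also have "\<dots> = a * ?l + g * (sqrt (real n) * \<bar>?s\<bar>)"
    using ag by (simp add: L2_set_right_distrib, simp add: L2_set_def real_sqrt_mult abs_mult)
  also have "\<dots> \<le> a * 1 + g * (sqrt (real n) * sqrt (real n))"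
    using ag nv s by (intro add_mono mult_left_mono) auto
  also have "\<dots> = a + real n * g" by simp
  finally show "euclid_norm (exch_mat n a g *\<^sub>v v) \<le> a + real n * g" .
qed

lemma correlation_mat_unit_diag:
  assumes S: "S \<in> carrier_mat n n" and d: "\<And>j. j < n \<Longrightarrow> S $$ (j, j) = 1"
  shows "correlation_mat n S = S"
proof -
  have "mat_diag n (\<lambda>j. 1 / std_dev S j) = 1\<^sub>m n"
    by (rule eq_matI) (auto simp: mat_diag_def std_dev_def d)
  then show ?thesis using S by (simp add: correlation_mat_def)
qed

text \<open>Packages the covariance matrix of the lower bound. The last property says that the noise
  has variance \<open>k\<close> along the all-ones direction, the most that the operator norm
  allows.\<close>

lemma exists_equicorrelation:
  assumes "1 \<le> k" "k \<le> real n"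
  obtains S where "psd_mat n S" "\<And>j. j < n \<Longrightarrow> S $$ (j, j) = 1" "op_norm (correlation_mat n S) \<le> k"
    "psd_sqrt n S \<in> carrier_mat n n"
    "psd_sqrt n S *\<^sub>v Matrix.vec n (\<lambda>_. 1) = Matrix.vec n (\<lambda>_. sqrt k)"
proof
  \<comment> \<open>Solves \<open>1 + (real n - 1) * r = k\<close>. If \<open>n = 1\<close> then
    \<open>k = 1\<close>, and division by zero yields \<open>r = 0\<close>, which still solves
    it.\<close>
  define r where "r = (k - 1) / (real n - 1)"
  \<comment> \<open>\<open>a\<close> and \<open>g\<close> give the root the eigenvalues
    \<open>sqrt (1 - r)\<close> on zero-sum vectors and \<open>sqrt k\<close> on the all-ones
    vector.\<close>
  define a where "a = sqrt (1 - r)"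
  define g where "g = (sqrt k - a) / real n"
  have n: "0 < n" using assms by (cases n) auto
  have r: "0 \<le> r" "r \<le> 1" "r * (real n - 1) = k - 1"
    using assms by (auto simp: r_def divide_le_eq_1)
  have a: "0 \<le> a" "a\<^sup>2 = 1 - r" "a \<le> sqrt k" using r assms by (auto simp: a_def)
  have g: "0 \<le> g" "a + real n * g = sqrt k" using a n by (auto simp: g_def)
  \<comment> \<open>\<open>n\<close> times the off-diagonal entry of the squared root is the
    difference of its two squared eigenvalues, \<open>k - (1 - r)\<close>.\<close>
  have "real n * (a * g + g * a + real n * g * g) = (a + real n * g)\<^sup>2 - a\<^sup>2"
    by (simp add: power2_eq_square algebra_simps)
  also have "\<dots> = real n * r" using a g r assms by (simp add: algebra_simps)
  finally have *: "a * g + g * a + real n * g * g = r" using n by simp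
  let ?E = "exch_mat n a g" and ?S = "exch_mat n (1 - r) r"
  have S: "?S = ?E * ?E"
    using * a by (simp add: exch_mat_mult power2_eq_square)
  have sqrt: "psd_sqrt n ?S = ?E" unfolding S by (rule psd_sqrt_exch_mat) fact+
  show "psd_mat n ?S" using r by (intro psd_exch_mat) auto
  show diag: "?S $$ (j, j) = 1" if "j < n" for j using that by (simp add: exch_mat_def)
  have "correlation_mat n ?S = ?S" using diag by (intro correlation_mat_unit_diag) auto
  moreover have "op_norm ?S \<le> (1 - r) + real n * r" using r by (intro op_norm_exch_mat_le) auto
  moreover have "(1 - r) + real n * r = k" using r by (simp add: algebra_simps)
  ultimately show "op_norm (correlation_mat n ?S) \<le> k" by simp
  show "psd_sqrt n ?S \<in> carrier_mat n n" by (simp add: sqrt)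
  show "psd_sqrt n ?S *\<^sub>v Matrix.vec n (\<lambda>_. 1) = Matrix.vec n (\<lambda>_. sqrt k)"
    unfolding sqrt using g by (intro eq_vecI) (simp_all add: exch_mat_mult_vec algebra_simps)
qed

section \<open>Normal mixtures and observation laws\<close>

lemma normal_mixture_nonneg [simp]: "0 \<le> normal_mixture G \<sigma> x"
  by (simp add: normal_mixture_def)

lemma normal_mixture_eq_nn_integral:
  assumes "sets G = sets borel"
  shows "normal_mixture G \<sigma> x = enn2real (\<integral>\<^sup>+u. ennreal (normal_density 0 \<sigma> (x - u)) \<partial>G)"
  unfolding normal_mixture_def
  by (rule integral_eq_nn_integral) (auto simp: measurable_cong_sets[OF assms refl])

text \<open>Joint measurability lets the Hellinger integral over \<open>x\<close> depend measurably
  on \<open>y\<close>, hence on the observation once \<open>L\<close> is an estimator. It comes from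
  the nonnegative integral, which is measurable along kernels.\<close>

lemma normal_mixture_kernel_measurable:
  fixes M :: "'a measure"
  assumes L: "L \<in> measurable M (prob_algebra borel)"
  shows "(\<lambda>(y, x). normal_mixture (L y) \<sigma> x) \<in> borel_measurable (M \<Otimes>\<^sub>M lborel)"
proof -
  have L'[measurable]: "L \<in> measurable M (subprob_algebra borel)"
    using L by (rule measurable_prob_algebraD)
  have "(\<lambda>p. \<integral>\<^sup>+u. ennreal (normal_density 0 \<sigma> (snd p - u)) \<partial>L (fst p)) \<in> borel_measurable (M \<Otimes>\<^sub>M lborel)"
    by (rule nn_integral_measurable_subprob_algebra2[where N = borel]) measurable
  then have "(\<lambda>p. enn2real (\<integral>\<^sup>+u. ennreal (normal_density 0 \<sigma> (snd p - u)) \<partial>L (fst p)))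
      \<in> borel_measurable (M \<Otimes>\<^sub>M lborel)"
    by measurable
  also have "?this \<longleftrightarrow> ?thesis"
  proof (rule measurable_cong)
    fix p :: "'a \<times> real" assume p: "p \<in> space (M \<Otimes>\<^sub>M lborel)"
    then have "L (fst p) \<in> space (prob_algebra borel)"
      using measurable_space[OF L] by (auto simp: space_pair_measure)
    then show "enn2real (\<integral>\<^sup>+u. ennreal (normal_density 0 \<sigma> (snd p - u)) \<partial>L (fst p))
        = (case p of (y, x) \<Rightarrow> normal_mixture (L y) \<sigma> x)"
      by (auto simp: space_prob_algebra normal_mixture_eq_nn_integral split: prod.split)
  qed
  finally show ?thesis .
qed

lemma normal_mixture_measurable [measurable]:
  assumes "G \<in> space (prob_algebra borel)"
  shows "normal_mixture G \<sigma> \<in> borel_measurable borel"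
proof -
  \<comment> \<open>A fixed measure is viewed as a kernel on a one-point space.\<close>
  have "(\<lambda>_. G) \<in> measurable (count_space {()}) (prob_algebra borel)"
    using assms by simp
  from measurable_compose[OF measurable_Pair1' normal_mixture_kernel_measurable[OF this, of \<sigma>], of "()"]
  show ?thesis by simp
qed

text \<open>Tonelli: integrating over \<open>x\<close> first, every translated normal density has
  mass 1.\<close>

lemma integrable_normal_mixture:
  assumes G: "G \<in> space (prob_algebra borel)" and "0 < \<sigma>"
  shows "integrable lborel (normal_mixture G \<sigma>)"
proof (rule integrableI_nonneg)
  interpret G: prob_space G using G by (simp add: space_prob_algebra)
  have sG[measurable_cong]: "sets G = sets borel" using G by (simp add: space_prob_algebra)
  interpret pair_sigma_finite lborel G by unfold_locales
  have "(\<integral>\<^sup>+x. ennreal (normal_mixture G \<sigma> x) \<partial>lborel)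
      \<le> (\<integral>\<^sup>+x. (\<integral>\<^sup>+u. ennreal (normal_density 0 \<sigma> (x - u)) \<partial>G) \<partial>lborel)"
    by (intro nn_integral_mono) (simp add: normal_mixture_eq_nn_integral[OF sG] ennreal_enn2real_if)
  also have "\<dots> = (\<integral>\<^sup>+u. (\<integral>\<^sup>+x. ennreal (normal_density 0 \<sigma> (x - u)) \<partial>lborel) \<partial>G)"
    by (rule Fubini'[symmetric]) measurable
  also have "\<dots> = (\<integral>\<^sup>+u. 1 \<partial>G)"
  proof (rule nn_integral_cong)
    fix u
    have "(\<integral>\<^sup>+x. ennreal (normal_density 0 \<sigma> (x - u)) \<partial>lborel)
        = (\<integral>\<^sup>+x. ennreal (normal_density u \<sigma> x) \<partial>lborel)"
      by (simp add: normal_density_def)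
    also have "\<dots> = 1"
      using \<open>0 < \<sigma>\<close> by (subst nn_integral_eq_integral) auto
    finally show "(\<integral>\<^sup>+x. ennreal (normal_density 0 \<sigma> (x - u)) \<partial>lborel) = 1" .
  qed
  also have "\<dots> < \<infinity>" using G.emeasure_space_1 by simp
  finally show "(\<integral>\<^sup>+x. ennreal (normal_mixture G \<sigma> x) \<partial>lborel) < \<infinity>" .
qed (use normal_mixture_measurable[OF G] in auto)

lemma point_mass_in_prob_algebra [simp]: "return borel (a::real) \<in> space (prob_algebra borel)"
  by (simp add: space_prob_algebra prob_space_return)

lemma normal_mixture_point_mass: "normal_mixture (return borel a) \<sigma> x = normal_density 0 \<sigma> (x - a)"
  unfolding normal_mixture_def by (rule integral_return) auto

text \<open>Makes the error events of an estimator measurable, as the two-point bound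
  requires.\<close>

lemma avg_hellinger_measurable:
  assumes L: "L \<in> measurable M (prob_algebra borel)" and G: "G \<in> space (prob_algebra borel)"
  shows "(\<lambda>y. avg_hellinger n \<sigma> (L y) G) \<in> borel_measurable M"
proof -
  note normal_mixture_kernel_measurable[OF L, measurable] normal_mixture_measurable[OF G, measurable]
  show ?thesis
    unfolding avg_hellinger_def hellinger_sq_def by measurable
qed

section \<open>Hellinger distances\<close>

lemma avg_hellinger_const:
  assumes "0 < n" "\<And>j. j < n \<Longrightarrow> \<sigma> j = s"
  shows "avg_hellinger n \<sigma> G H = sqrt (hellinger_sq (normal_mixture G s) (normal_mixture H s))"
  using assms by (simp add: avg_hellinger_def)

lemma hellinger_sq_commute: "hellinger_sq f g = hellinger_sq g f"
  by (simp add: hellinger_sq_def power2_commute)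

text \<open>The integrand is dominated by \<open>f x + g x\<close>. This rules out the default value
  0 of the integral in \<open>hellinger_sq\<close>.\<close>

lemma integrable_sqrt_diff_sq:
  fixes f g :: "real \<Rightarrow> real"
  assumes f: "integrable lborel f" and g: "integrable lborel g" and "\<And>x. 0 \<le> f x" "\<And>x. 0 \<le> g x"
  shows "integrable lborel (\<lambda>x. (sqrt (f x) - sqrt (g x))\<^sup>2)"
proof (rule Bochner_Integration.integrable_bound)
  show "integrable lborel (\<lambda>x. f x + g x)" using f g by simp
  show "(\<lambda>x. (sqrt (f x) - sqrt (g x))\<^sup>2) \<in> borel_measurable lborel"
    using borel_measurable_integrable[OF f] borel_measurable_integrable[OF g] by measurable
  show "AE x in lborel. norm ((sqrt (f x) - sqrt (g x))\<^sup>2) \<le> norm (f x + g x)"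
  proof (rule AE_I2)
    fix x
    have "0 \<le> sqrt (f x) * sqrt (g x)" using assms by simp
    moreover have "(sqrt (f x) - sqrt (g x))\<^sup>2 = f x + g x - 2 * (sqrt (f x) * sqrt (g x))"
      using assms by (simp add: power2_diff)
    ultimately have "(sqrt (f x) - sqrt (g x))\<^sup>2 \<le> f x + g x" by linarith
    then show "norm ((sqrt (f x) - sqrt (g x))\<^sup>2) \<le> norm (f x + g x)" using assms by simp
  qed
qed

text \<open>A pointwise quadratic inequality replaces Minkowski; the lost factor 2 only affects
  constants.\<close>

lemma hellinger_sq_triangle:
  assumes "integrable lborel f" "integrable lborel g" "integrable lborel h"
    and "\<And>x. 0 \<le> f x" "\<And>x. 0 \<le> g x" "\<And>x. 0 \<le> h x"
  shows "hellinger_sq f h \<le> 2 * hellinger_sq f g + 2 * hellinger_sq g h"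
proof -
  let ?d = "\<lambda>u v (x::real). (sqrt (u x) - sqrt (v x))\<^sup>2"
  have "(LINT x|lborel. ?d f h x) \<le> (LINT x|lborel. 2 * ?d f g x + 2 * ?d g h x)"
  proof (rule integral_mono)
    \<comment> \<open>Parallelogram law: the two sides differ by exactly
      \<open>(u - 2 * v + w)\<^sup>2\<close>.\<close>
    have "(u - w)\<^sup>2 \<le> 2 * (u - v)\<^sup>2 + 2 * (v - w)\<^sup>2" for u v w :: real
      using zero_le_power2[of "u - 2 * v + w"] by (simp add: power2_eq_square algebra_simps)
    then show "?d f h x \<le> 2 * ?d f g x + 2 * ?d g h x" for x .
  qed (intro Bochner_Integration.integrable_add integrable_mult_right integrable_sqrt_diff_sq assms)+
  also have "\<dots> = 2 * (LINT x|lborel. ?d f g x) + 2 * (LINT x|lborel. ?d g h x)"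
    by (simp add: integrable_sqrt_diff_sq assms)
  finally show ?thesis by (simp add: hellinger_sq_def)
qed

text \<open>In the product of the two densities the terms linear in \<open>x\<close> cancel, so
  their geometric mean is the centred density times \<open>exp (- (a\<^sup>2 / 2))\<close>, which is
  the Hellinger affinity.\<close>

lemma hellinger_sq_normal_shift:
  "hellinger_sq (\<lambda>x. normal_density 0 1 (x - a)) (\<lambda>x. normal_density 0 1 (x - (- a))) = 1 - exp (- (a\<^sup>2 / 2))"
proof -
  have m: "normal_density 0 1 (x - c) = normal_density c 1 x" for x c :: real
    by (simp add: normal_density_def)
  have "normal_density a 1 x * normal_density (- a) 1 x = (exp (- (a\<^sup>2 / 2)) * std_normal_density x)\<^sup>2" for x
    by (simp add: normal_density_def power_mult_distrib power2_eq_square exp_add[symmetric] algebra_simps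
      add_divide_distrib diff_divide_distrib)
  then have "sqrt (normal_density a 1 x) * sqrt (normal_density (- a) 1 x)
      = exp (- (a\<^sup>2 / 2)) * std_normal_density x" for x
    by (simp add: real_sqrt_mult[symmetric])
  then have "(sqrt (normal_density a 1 x) - sqrt (normal_density (- a) 1 x))\<^sup>2
     = normal_density a 1 x + normal_density (- a) 1 x - 2 * (exp (- (a\<^sup>2 / 2)) * std_normal_density x)" for x
    by (simp add: power2_diff)
  then show ?thesis
    unfolding hellinger_sq_def m by simp
qed

section \<open>Point-mass priors and their observation laws\<close>

lemma point_mass_in_compact_priors:
  assumes "\<bar>a\<bar> \<le> M"
  shows "return borel a \<in> compact_priors M"
proof -
  have "x \<in> {-M..M}" if "x \<in> topological_support (return borel a)" for x
  proof (rule ccontr)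
    assume x: "x \<notin> {-M..M}"
    have "open (- {-M..M})" by (simp add: open_Compl)
    with that x have "0 < measure (return borel a) (- {-M..M})"
      by (auto simp: topological_support_def)
    then show False using assms by (simp add: measure_return abs_le_iff indicator_def split: if_splits)
  qed
  then show ?thesis by (auto simp: compact_priors_def)
qed

text \<open>Also true for non-measurable \<open>f\<close>, where \<^const>\<open>distr\<close> may degenerate to the null measure.\<close>

lemma measure_distr_le_1:
  assumes "prob_space N"
  shows "measure (distr N M f) A \<le> 1"
proof -
  interpret prob_space N by fact
  have "emeasure (distr N M f) A \<le> 1"
    unfolding distr_def by (auto simp: emeasure_measure_of_conv emeasure_le_1)
  then show ?thesis by (simp add: measure_def enn2real_leI)
qed

text \<open>Bounds the family of error probabilities, so that its real supremum dominates each
  member.\<close>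

lemma measure_obs_law_le_1:
  assumes "G \<in> space (prob_algebra borel)"
  shows "measure (obs_law n G S) A \<le> 1"
  unfolding obs_law_def
  by (intro measure_distr_le_1 prob_space_pair prob_space_PiM prob_space_normal_density)
    (use assms in \<open>auto simp: space_prob_algebra\<close>)

lemma mult_vec_measurable:
  assumes "A \<in> carrier_mat n n" "i < n"
  shows "(\<lambda>z. vec_index (A *\<^sub>v Matrix.vec n z) i) \<in> borel_measurable (obs_space n)"
proof -
  have "vec_index (A *\<^sub>v Matrix.vec n z) i = (\<Sum>j<n. A $$ (i, j) * z j)" for z
    using assms by (simp add: scalar_prod_def lessThan_atLeast0)
  then show ?thesis by simp
qed

text \<open>A product of point masses is the point mass at the constant vector; integrating it out
  leaves one slice of the event under the Gaussian law.\<close>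

lemma measure_obs_law_point_mass:
  assumes A: "psd_sqrt n S \<in> carrier_mat n n" and X: "X \<in> sets (obs_space n)"
  shows "measure (obs_law n (return borel a) S) X =
    measure (gauss_vec n) {z \<in> space (obs_space n).
      (\<lambda>i\<in>{..<n}. a + vec_index (psd_sqrt n S *\<^sub>v Matrix.vec n z) i) \<in> X}"
proof -
  note [measurable] = mult_vec_measurable[OF A] X
  interpret prob_space "gauss_vec n" by (rule prob_space_gauss_vec)
  let ?f = "\<lambda>(\<beta>, z). \<lambda>i\<in>{..<n}. \<beta> i + vec_index (psd_sqrt n S *\<^sub>v Matrix.vec n z) i"
  have f: "?f \<in> measurable (obs_space n \<Otimes>\<^sub>M gauss_vec n) (obs_space n)"
    by (simp add: split_beta') measurable
  have R: "PiM {..<n} (\<lambda>_. return borel a) = return (obs_space n) (\<lambda>i\<in>{..<n}. a)"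
    by (rule PiM_return) auto
  have s: "sets (return (obs_space n) (\<lambda>i\<in>{..<n}. a) \<Otimes>\<^sub>M gauss_vec n) = sets (obs_space n \<Otimes>\<^sub>M gauss_vec n)"
    by (intro sets_pair_measure_cong) auto
  have a: "(\<lambda>i\<in>{..<n}. a) \<in> space (obs_space n)" by (simp add: space_PiM)
  let ?P = "?f -` X \<inter> space (obs_space n \<Otimes>\<^sub>M gauss_vec n)"
  have P: "?P \<in> sets (obs_space n \<Otimes>\<^sub>M gauss_vec n)" using f X by (rule measurable_sets)
  have "emeasure (obs_law n (return borel a) S) X
     = emeasure (distr (return (obs_space n) (\<lambda>i\<in>{..<n}. a) \<Otimes>\<^sub>M gauss_vec n) (obs_space n) ?f) X"
    unfolding obs_law_def R gauss_vec_def std_gauss_def ..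
  also have "\<dots> = emeasure (return (obs_space n) (\<lambda>i\<in>{..<n}. a) \<Otimes>\<^sub>M gauss_vec n) ?P"
    using f X s by (subst emeasure_distr) (auto simp: measurable_cong_sets[OF s refl] sets_eq_imp_space_eq[OF s])
  also have "\<dots> = (\<integral>\<^sup>+\<beta>. emeasure (gauss_vec n) (Pair \<beta> -` ?P) \<partial>return (obs_space n) (\<lambda>i\<in>{..<n}. a))"
    using P s by (intro emeasure_pair_measure_alt) auto
  also have "\<dots> = emeasure (gauss_vec n) (Pair (\<lambda>i\<in>{..<n}. a) -` ?P)"
    using P by (intro nn_integral_return a measurable_emeasure_Pair)
  also have "Pair (\<lambda>i\<in>{..<n}. a) -` ?P = {z \<in> space (obs_space n).
      (\<lambda>i\<in>{..<n}. a + vec_index (psd_sqrt n S *\<^sub>v Matrix.vec n z) i) \<in> X}"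
    using a by (auto simp: space_pair_measure cong: restrict_cong)
  finally show ?thesis by (simp add: measure_def)
qed

section \<open>The two-point lower bound\<close>

text \<open>\<open>X\<close> and \<open>Y\<close> stand for the error events under the two priors;
  that they cover the space says that no estimate is close to both.\<close>

lemma two_point_mass_lower_bound:
  assumes S: "psd_sqrt n S \<in> carrier_mat n n"
    and ones: "psd_sqrt n S *\<^sub>v Matrix.vec n (\<lambda>_. 1) = Matrix.vec n (\<lambda>_. sqrt k)"
    and k: "0 < k" and a: "real n * a\<^sup>2 \<le> k / 64"
    and X: "X \<in> sets (obs_space n)" and Y: "Y \<in> sets (obs_space n)" and XY: "X \<union> Y = space (obs_space n)"
  shows "1/2 \<le> measure (obs_law n (return borel a) S) X + measure (obs_law n (return borel (- a)) S) Y"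
proof -
  interpret prob_space "gauss_vec n" by (rule prob_space_gauss_vec)
  let ?A = "psd_sqrt n S" and ?b = "a / sqrt k"
  define T where "T z = (\<lambda>i\<in>{..<n}. vec_index (?A *\<^sub>v Matrix.vec n z) i)" for z
  note [measurable] = mult_vec_measurable[OF S]
  have T: "T \<in> measurable (obs_space n) (obs_space n)"
    unfolding T_def by measurable
  \<comment> \<open>By \<open>ones\<close>, adding \<open>c\<close> to every observed coordinate
    amounts to shifting the Gaussian vector by \<open>c / sqrt k\<close> before applying
    \<open>?A\<close>.\<close>
  have shift: "(\<lambda>i\<in>{..<n}. c + vec_index (?A *\<^sub>v Matrix.vec n z) i) = T (shift_vec n (c / sqrt k) z)" for c z
  proof -
    let ?o = "Matrix.vec n (\<lambda>_. 1 :: real)"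
    have "Matrix.vec n (shift_vec n (c / sqrt k) z) = Matrix.vec n z + (c / sqrt k) \<cdot>\<^sub>v ?o"
      by (rule eq_vecI) (auto simp: shift_vec_def)
    then have "?A *\<^sub>v Matrix.vec n (shift_vec n (c / sqrt k) z)
        = ?A *\<^sub>v Matrix.vec n z + (c / sqrt k) \<cdot>\<^sub>v (?A *\<^sub>v ?o)"
      using S by (simp add: mult_add_distrib_mat_vec[OF S] mult_mat_vec[OF S])
    then show ?thesis
      using k S unfolding T_def ones by (auto intro!: restrict_ext)
  qed
  define V W where "V = T -` X \<inter> space (obs_space n)" and "W = T -` Y \<inter> space (obs_space n)"
  have V: "V \<in> sets (obs_space n)" unfolding V_def using T X by (rule measurable_sets)
  have W: "W \<in> sets (obs_space n)" unfolding W_def using T Y by (rule measurable_sets)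
  have law: "measure (obs_law n (return borel c) S) Z
      = prob (shift_vec n (c / sqrt k) -` (T -` Z \<inter> space (obs_space n)) \<inter> space (obs_space n))"
    if "Z \<in> sets (obs_space n)" for Z c
    unfolding measure_obs_law_point_mass[OF S that] shift
    using measurable_space[OF shift_vec_measurable] by (intro arg_cong[where f = prob]) auto
  have mV: "shift_vec n b -` V \<inter> space (obs_space n) \<in> events" for b
    using measurable_sets[OF shift_vec_measurable V] by simp
  have mW: "shift_vec n b -` W \<inter> space (obs_space n) \<in> events" for b
    using measurable_sets[OF shift_vec_measurable W] by simp
  have "real n * ?b\<^sup>2 \<le> 1/64" using a k by (simp add: power_divide field_simps)
  then have "prob (shift_vec n (- ?b) -` V \<inter> space (obs_space n))
      \<le> prob (shift_vec n ?b -` V \<inter> space (obs_space n)) + 1/2"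
    using gauss_vec_shift_indistinguishable[OF V, of "- ?b"] by simp
  \<comment> \<open>Under the prior at \<open>- a\<close> the two events have total probability at
    least 1; moving \<open>X\<close> over to the prior at \<open>a\<close> costs at most
    1/2.\<close>
  moreover have "1 \<le> prob (shift_vec n (- ?b) -` V \<inter> space (obs_space n))
      + prob (shift_vec n (- ?b) -` W \<inter> space (obs_space n))"
  proof -
    have "V \<union> W = space (obs_space n)"
      unfolding V_def W_def using XY measurable_space[OF T] by blast
    then have "space (gauss_vec n) = (shift_vec n (- ?b) -` V \<inter> space (obs_space n))
      \<union> (shift_vec n (- ?b) -` W \<inter> space (obs_space n))"
      using measurable_space[OF shift_vec_measurable] by fastforce
    then show ?thesis
      using measure_Un_le[OF mV mW, of "- ?b" "- ?b"] prob_space by simp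
  qed
  moreover have "measure (obs_law n (return borel a) S) X = prob (shift_vec n ?b -` V \<inter> space (obs_space n))"
    unfolding V_def by (rule law[OF X])
  moreover have "measure (obs_law n (return borel (- a)) S) Y = prob (shift_vec n (- ?b) -` W \<inter> space (obs_space n))"
    unfolding W_def using law[OF Y, of "- a"] by simp
  ultimately show ?thesis by linarith
qed

text \<open>If both distances were at most \<open>r\<close>, the squared triangle inequality would
  place the two normal laws within squared distance \<open>4 * r\<^sup>2\<close>, whereas it is at
  least \<open>a\<^sup>2 / 4\<close>.\<close>

lemma hellinger_separation:
  assumes G: "G \<in> space (prob_algebra borel)" and n: "0 < n" and \<sigma>: "\<And>j. j < n \<Longrightarrow> \<sigma> j = 1"
    and a: "a\<^sup>2 \<le> 2" and r: "0 \<le> r" "16 * r\<^sup>2 < a\<^sup>2"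
  shows "r < avg_hellinger n \<sigma> G (return borel a) \<or> r < avg_hellinger n \<sigma> G (return borel (- a))"
proof (rule ccontr)
  let ?h = "\<lambda>c. hellinger_sq (normal_mixture G 1) (normal_mixture (return borel c) 1)"
  assume "\<not> ?thesis"
  then have "sqrt (?h a) \<le> r" "sqrt (?h (- a)) \<le> r"
    using avg_hellinger_const[OF n \<sigma>] by (simp_all add: not_less)
  then have h: "?h a \<le> r\<^sup>2" "?h (- a) \<le> r\<^sup>2"
    using sqrt_le_D by auto
  have "hellinger_sq (normal_mixture (return borel a) 1) (normal_mixture (return borel (- a)) 1)
      \<le> 2 * hellinger_sq (normal_mixture (return borel a) 1) (normal_mixture G 1) + 2 * ?h (- a)"
    by (intro hellinger_sq_triangle integrable_normal_mixture G) auto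
  also have "\<dots> \<le> 4 * r\<^sup>2" using h by (simp add: hellinger_sq_commute)
  finally have "1 - exp (- (a\<^sup>2 / 2)) \<le> 4 * r\<^sup>2"
    unfolding normal_mixture_point_mass hellinger_sq_normal_shift .
  \<comment> \<open>With \<open>t = a\<^sup>2 / 2 \<le> 1\<close>:
    \<open>exp (- t) \<le> 1 / (1 + t)\<close>, and
    \<open>(1 - t / 2) * (1 + t) \<ge> 1\<close>.\<close>
  moreover have "exp (- (a\<^sup>2 / 2)) \<le> 1 - a\<^sup>2 / 4"
  proof -
    have "exp (- (a\<^sup>2 / 2)) = 1 / exp (a\<^sup>2 / 2)" by (simp add: exp_minus field_simps)
    also have "\<dots> \<le> 1 / (1 + a\<^sup>2 / 2)"
      using exp_ge_add_one_self[of "a\<^sup>2 / 2"] by (intro divide_left_mono) (auto intro!: mult_pos_pos add_pos_nonneg)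
    also have "\<dots> \<le> 1 - a\<^sup>2 / 4"
    proof -
      have "a\<^sup>2 * a\<^sup>2 \<le> a\<^sup>2 * 2" by (rule mult_left_mono) (use a in auto)
      then have "1 \<le> (1 - a\<^sup>2 / 4) * (1 + a\<^sup>2 / 2)" by (simp add: algebra_simps)
      then show ?thesis by (subst pos_divide_le_eq) (auto intro: add_pos_nonneg)
    qed
    finally show ?thesis .
  qed
  ultimately show False using r by simp
qed

theorem proposition2p3:
  fixes M :: real
  assumes "M > 1"
  shows "\<exists>c\<^sub>1 > 0. \<forall>(n::nat) (\<kappa>\<^sub>0::real). \<kappa>\<^sub>0 \<ge> 1 \<and> real n / \<kappa>\<^sub>0 \<ge> c\<^sub>1 \<longrightarrow>
    (INF Gt \<in> measurable (obs_space n) (prob_algebra (borel :: real measure)).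
       SUP (G\<^sub>0, \<Sigma>\<^sub>0) \<in> param_class n M \<kappa>\<^sub>0.
         \<P>(U in obs_law n G\<^sub>0 \<Sigma>\<^sub>0.
            avg_hellinger n (std_dev \<Sigma>\<^sub>0) (Gt U) G\<^sub>0 > (real n / \<kappa>\<^sub>0) powr (-1/2) / c\<^sub>1)) \<ge> 1/4"
proof (intro exI[of _ "40::real"] conjI allI impI)
  fix n :: nat and k :: real
  assume nk: "1 \<le> k \<and> 40 \<le> real n / k"
  then have "0 < k" by simp
  with nk have nk': "40 * k \<le> real n" by (simp add: pos_le_divide_eq)
  with nk have n: "0 < n" "1 \<le> k" "k \<le> real n" by (auto intro!: gr0I)
  obtain S where S: "psd_mat n S" "\<And>j. j < n \<Longrightarrow> S $$ (j, j) = 1" "op_norm (correlation_mat n S) \<le> k"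
    "psd_sqrt n S \<in> carrier_mat n n"
    "psd_sqrt n S *\<^sub>v Matrix.vec n (\<lambda>_. 1) = Matrix.vec n (\<lambda>_. sqrt k)"
    using exists_equicorrelation[OF n(2,3)] by metis
  have kn: "0 < k / real n" "k / real n \<le> 1" using n by auto
  \<comment> \<open>The constant 40 makes \<open>16 * r\<^sup>2 = k / (100 * n)\<close> smaller than
    \<open>a\<^sup>2 = k / (64 * n)\<close>; any constant above 32 achieves this.\<close>
  define r where "r = (real n / k) powr (-1/2) / 40"
  \<comment> \<open>The largest separation with \<open>real n * a\<^sup>2 \<le> k / 64\<close>, the
    limit of indistinguishability.\<close>
  define a where "a = sqrt (k / real n) / 8"
  have "(real n / k) powr (-1/2) = sqrt (k / real n)"
    using n by (simp add: powr_minus powr_half_sqrt real_sqrt_divide)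
  then have r: "0 \<le> r" "r\<^sup>2 = k / real n / 1600" using kn by (simp_all add: r_def power_divide del: zero_less_divide_iff)
  have a2: "a\<^sup>2 = k / real n / 64" using kn by (simp add: a_def power_divide del: zero_less_divide_iff)
  have sep: "16 * r\<^sup>2 < a\<^sup>2" "a\<^sup>2 \<le> 2" using kn by (simp_all add: r a2 del: zero_less_divide_iff)
  have "\<bar>a\<bar> \<le> 1 / 8" using kn by (simp add: a_def)
  then have aM: "\<bar>a\<bar> \<le> M" "\<bar>- a\<bar> \<le> M" using assms by auto
  have param: "(return borel c, S) \<in> param_class n M k" if "\<bar>c\<bar> \<le> M" for c
    using that S by (auto simp: param_class_def point_mass_in_compact_priors)
  let ?p = "\<lambda>Gt. \<lambda>(G, S). \<P>(U in obs_law n G S. r < avg_hellinger n (std_dev S) (Gt U) G)"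
  show "(INF Gt \<in> measurable (obs_space n) (prob_algebra (borel :: real measure)).
       SUP (G\<^sub>0, \<Sigma>\<^sub>0) \<in> param_class n M k.
         \<P>(U in obs_law n G\<^sub>0 \<Sigma>\<^sub>0.
            avg_hellinger n (std_dev \<Sigma>\<^sub>0) (Gt U) G\<^sub>0 > (real n / k) powr (-1/2) / 40)) \<ge> 1/4"
    unfolding r_def[symmetric]
  proof (rule cINF_greatest)
    have "(\<lambda>_. return borel 0) \<in> measurable (obs_space n) (prob_algebra (borel :: real measure))"
      by (rule measurable_const) simp
    then show "measurable (obs_space n) (prob_algebra (borel :: real measure)) \<noteq> {}" by blast
    fix Gt assume Gt: "Gt \<in> measurable (obs_space n) (prob_algebra (borel :: real measure))"
    have "bdd_above (?p Gt ` param_class n M k)"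
      by (rule bdd_aboveI2[where M = 1]) (auto simp: param_class_def compact_priors_def intro: measure_obs_law_le_1)
    then have ub: "?p Gt (return borel c, S) \<le> (SUP (G, S) \<in> param_class n M k. ?p Gt (G, S))"
      if "\<bar>c\<bar> \<le> M" for c
      using cSUP_upper[OF param[OF that], of "?p Gt"] by (simp add: split_def)
    define X where "X c = {U \<in> space (obs_space n). r < avg_hellinger n (std_dev S) (Gt U) (return borel c)}" for c
    have X: "X c \<in> sets (obs_space n)" for c
      using avg_hellinger_measurable[OF Gt point_mass_in_prob_algebra, of n "std_dev S" c]
      unfolding X_def by measurable
    have pX: "?p Gt (return borel c, S) = measure (obs_law n (return borel c) S) (X c)" for c
      by (simp add: X_def obs_law_def)
    have "r < avg_hellinger n (std_dev S) (Gt U) (return borel a)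
        \<or> r < avg_hellinger n (std_dev S) (Gt U) (return borel (- a))"
      if "U \<in> space (obs_space n)" for U
      using measurable_space[OF Gt that] n sep r S
      by (intro hellinger_separation) (auto simp: std_dev_def)
    then have "X a \<union> X (- a) = space (obs_space n)" by (auto simp: X_def)
    from two_point_mass_lower_bound[OF S(4,5) _ _ X X this]
    have "1/2 \<le> ?p Gt (return borel a, S) + ?p Gt (return borel (- a), S)"
      unfolding pX using n a2 by simp
    \<comment> \<open>Two error probabilities with sum at least 1/2 both lie below the supremum, so
      it is at least 1/4.\<close>
    with ub[OF aM(1)] ub[OF aM(2)]
    show "1/4 \<le> (SUP (G, S) \<in> param_class n M k. \<P>(U in obs_law n G S. r < avg_hellinger n (std_dev S) (Gt U) G))"
      by simp
  qed
qed simp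

end
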